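(* Let $G$ be a weighted, marked graph. Suppose $k\geq 3$ is odd and $v_1,\dots,v_k$ are unmarked, pairwise nonadjacent, unlooped twins in $G$ (i.e. they all have the same neighbors). Then $[G]=[(G-v_2-\dots-v_k)']$, where $(G-v_2-\dots-v_k)'$ is obtained from $G-v_2-\dots-v_k$ by changing the weights of $v_1$ to $$\beta'(v_1)=\prod_{i=1}^k\beta(v_i)\quad\text{and}\quad \alpha'(v_1)=d^{-1}\Big(-\beta'(v_1)+\prod_{i=1}^k(\alpha(v_i)d+\beta(v_i))\Big).$$
   Context: A graph $G=(V(G),E(G))$ is finite and may have loops, multiple edges, and free loops (connected components that contain neither vertices nor edges). A marked graph is a graph each of whose vertices is designated either marked or unmarked. A weighted, marked graph is a marked graph given with functions $\alpha,\beta:V(G)\to R$, where $R$ is a commutative ring containing the element $d$, and $d$ is not a zero divisor in $R$ (for instance $d$ is an independent variable). The element $d^{-1}(\cdots)$ in the claim is the unique $x\in R$ with $dx=(\cdots)$; it exists because $\prod_i(\alpha(v_i)d+\beta(v_i))-\prod_i\beta(v_i)$ is a multiple of $d$. If $V(G)=\{v_1,\dots,v_n\}$, the Boolean adjacency matrix $\mathcal{A}(G)$ is the $n\times n$ matrix over $GF(2)$ with $\mathcal{A}(G)_{ii}=1$ iff $v_i$ is looped and, for $i\neq j$, $\mathcal{A}(G)_{ij}=1$ iff $v_i$ and $v_j$ are adjacent. For $T\subseteq V(G)$, $\mathcal{A}(G)_T$ is obtained from $\mathcal{A}(G)$ by first changing the $i$th diagonal entry whenever $v_i\in T$, and then removing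 the $i$th row and column whenever $v_i$ is marked and the (new) $i$th diagonal entry is $0$. The weighted marked-graph bracket polynomial is $$[G]=d^{\phi}\sum_{T\subseteq V(G)}\Big(\prod_{v\notin T}\alpha(v)\Big)\Big(\prod_{t\in T}\beta(t)\Big)d^{\nu(\mathcal{A}(G)_T)},$$ where $\phi$ is the number of free loops of $G$ and $\nu$ is the $GF(2)$-nullity (the empty matrix has nullity $0$). Vertices $v,w$ are twins if they have the same neighbors outside $\{v,w\}$. $G-v$ is obtained from $G$ by removing $v$ and every edge incident on $v$; remaining vertices keep their loops, marks and weights, and free loops are unaffected. *)

theory Defs
  imports
    "HOL-Library.Z2"
    "Jordan_Normal_Form.Matrix_Kernel"
    "Jordan_Normal_Form.DL_Submatrix"
begin

text \<open>
  The set \<open>ends e\<close> has two elements for an ordinary edge and one element for a loop; distinct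
  edges may have the same ends. A free loop has neither vertices nor edges, so only the number of
  free loops is recorded. Only the values of \<open>alpha\<close> and \<open>beta\<close> on \<open>verts\<close> are meaningful.
\<close>

record ('v, 'e, 'r) wm_graph =
  verts :: "'v set"
  edges :: "'e set"
  ends :: "'e \<Rightarrow> 'v set"
  free_loops :: nat
  marked :: "'v set"
  alpha :: "'v \<Rightarrow> 'r"
  beta :: "'v \<Rightarrow> 'r"

locale weighted_marked_graph =
  fixes G :: "('v, 'e, 'r :: comm_ring_1) wm_graph"
  assumes finite_verts: "finite (verts G)"
    and finite_edges: "finite (edges G)"
    and ends_in_verts: "\<And>e. e \<in> edges G \<Longrightarrow> ends G e \<subseteq> verts G"
    and card_ends: "\<And>e. e \<in> edges G \<Longrightarrow> card (ends G e) \<in> {1, 2}"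
    and marked_in_verts: "marked G \<subseteq> verts G"

definition looped :: "('v, 'e, 'r) wm_graph \<Rightarrow> 'v \<Rightarrow> bool" where
  "looped G v \<longleftrightarrow> (\<exists>e \<in> edges G. ends G e = {v})"

definition adjacent :: "('v, 'e, 'r) wm_graph \<Rightarrow> 'v \<Rightarrow> 'v \<Rightarrow> bool" where
  "adjacent G v w \<longleftrightarrow> v \<noteq> w \<and> (\<exists>e \<in> edges G. ends G e = {v, w})"

definition neighbors :: "('v, 'e, 'r) wm_graph \<Rightarrow> 'v \<Rightarrow> 'v set" where
  "neighbors G v = {w \<in> verts G. adjacent G v w}"

definition twins :: "('v, 'e, 'r) wm_graph \<Rightarrow> 'v \<Rightarrow> 'v \<Rightarrow> bool" where
  "twins G v w \<longleftrightarrow> neighbors G v - {v, w} = neighbors G w - {v, w}"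

definition del_vertex :: "('v, 'e, 'r) wm_graph \<Rightarrow> 'v \<Rightarrow> ('v, 'e, 'r) wm_graph" where
  "del_vertex G v = G\<lparr>verts := verts G - {v}, edges := {e \<in> edges G. v \<notin> ends G e},
     marked := marked G - {v}\<rparr>"

definition reweight :: "('v, 'e, 'r) wm_graph \<Rightarrow> 'v \<Rightarrow> 'r \<Rightarrow> 'r \<Rightarrow> ('v, 'e, 'r) wm_graph" where
  "reweight G v a b = G\<lparr>alpha := (alpha G)(v := a), beta := (beta G)(v := b)\<rparr>"

text \<open>
  Matrices over the two-element field \<^typ>\<open>bit\<close>, whose rows and columns are indexed by the positions
  in an enumeration \<open>vs\<close> of the vertices.
\<close>

definition bool_adj_mat :: "('v, 'e, 'r) wm_graph \<Rightarrow> 'v list \<Rightarrow> bit mat" where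
  "bool_adj_mat G vs = mat (length vs) (length vs)
     (\<lambda>(i, j). if i = j then of_bool (looped G (vs ! i))
               else of_bool (adjacent G (vs ! i) (vs ! j)))"

definition toggled_mat :: "('v, 'e, 'r) wm_graph \<Rightarrow> 'v list \<Rightarrow> 'v set \<Rightarrow> bit mat" where
  "toggled_mat G vs T = mat (length vs) (length vs)
     (\<lambda>(i, j). bool_adj_mat G vs $$ (i, j) + of_bool (i = j \<and> vs ! i \<in> T))"

definition reduced_mat :: "('v, 'e, 'r) wm_graph \<Rightarrow> 'v list \<Rightarrow> 'v set \<Rightarrow> bit mat" where
  "reduced_mat G vs T =
     (let A = toggled_mat G vs T;
          I = {i. i < length vs \<and> \<not> (vs ! i \<in> marked G \<and> A $$ (i, i) = 0)}
      in submatrix A I I)"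

definition vertex_enum :: "('v, 'e, 'r) wm_graph \<Rightarrow> 'v list" where
  "vertex_enum G = (SOME vs. distinct vs \<and> set vs = verts G)"

definition bracket :: "'r :: comm_ring_1 \<Rightarrow> ('v, 'e, 'r) wm_graph \<Rightarrow> 'r" where
  "bracket d G = d ^ free_loops G *
     (\<Sum>T \<in> Pow (verts G). (\<Prod>v \<in> verts G - T. alpha G v) * (\<Prod>t \<in> T. beta G t)
        * d ^ kernel_dim (reduced_mat G (vertex_enum G) T))"

definition quotient_by :: "'r :: comm_ring_1 \<Rightarrow> 'r \<Rightarrow> 'r" where
  "quotient_by d y = (THE x. d * x = y)"



text \<open>
  The nullity in \<^const>\<open>bracket\<close> does not depend on the enumeration of the vertices
  (\<open>kernel_dim_reduced_mat\<close>), and \<^const>\<open>quotient_by\<close> is division of multiples of a non zero divisor.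
\<close>

lemma reduced_mat_filter:
  fixes G vs T
  defines "f \<equiv> \<lambda>u w. (if u = w then of_bool (looped G u) + of_bool (u \<in> T) else of_bool (adjacent G u w)) :: bit"
  defines "us \<equiv> filter (\<lambda>u. \<not> (u \<in> marked G \<and> f u u = 0)) vs"
  assumes "distinct vs"
  shows "reduced_mat G vs T = mat (length us) (length us) (\<lambda>(i, j). f (us ! i) (us ! j))"
proof -
  define A where "A = toggled_mat G vs T"
  define I where "I = {i. i < length vs \<and> \<not> (vs ! i \<in> marked G \<and> A $$ (i, i) = 0)}"
  have A: "A $$ (i, j) = f (vs ! i) (vs ! j)" if "i < length vs" "j < length vs" for i j
    using that assms(3)
    by (auto simp: A_def toggled_mat_def bool_adj_mat_def f_def nth_eq_iff_index_eq)
  have dims: "dim_row A = length vs" "dim_col A = length vs"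
    by (auto simp: A_def toggled_mat_def)
  have I: "I = {i. i < length vs \<and> \<not> (vs ! i \<in> marked G \<and> f (vs ! i) (vs ! i) = 0)}"
    unfolding I_def using A by auto
  have us: "us = nths vs I"
    unfolding us_def I by (rule filter_eq_nths)
  have len: "length us = card {i. i < length vs \<and> i \<in> I}"
    unfolding us length_nths ..
  have sub: "{i. i < length vs \<and> i \<in> I} = I" unfolding I_def by auto
  have pk: "pick I i < length vs" "us ! i = vs ! pick I i" if "i < length us" for i
  proof -
    have "i < card I" using that len sub by simp
    hence "pick I i \<in> I" by (rule pick_in_set_le)
    thus "pick I i < length vs" by (simp add: I_def)
    show "us ! i = vs ! pick I i"
      unfolding us using that len by (intro nth_nths) auto
  qed
  have "reduced_mat G vs T = submatrix A I I"
    by (simp add: reduced_mat_def A_def I_def Let_def)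
  also have "\<dots> = mat (length us) (length us) (\<lambda>(i, j). A $$ (pick I i, pick I j))"
    unfolding submatrix_def dims len ..
  also have "\<dots> = mat (length us) (length us) (\<lambda>(i, j). f (us ! i) (us ! j))"
    by (rule cong_mat) (auto simp: pk A)
  finally show ?thesis .
qed

lemma sum_nth_distinct:
  assumes "distinct xs"
  shows "(\<Sum>l = 0..<length xs. g (xs ! l)) = sum g (set xs)"
  using assms by (intro sum.reindex_bij_betw bij_betw_nth) (auto simp: atLeast0LessThan)

lemma kernel_dim_reorder:
  fixes f :: "'v \<Rightarrow> 'v \<Rightarrow> 'a :: field"
  assumes xs: "distinct xs" and ys: "distinct ys" and eq: "set xs = set ys"
  shows "kernel_dim (mat (length xs) (length xs) (\<lambda>(i, j). f (xs ! i) (xs ! j))) =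
         kernel_dim (mat (length ys) (length ys) (\<lambda>(i, j). f (ys ! i) (ys ! j)))"
proof -
  define n where "n = length xs"
  have n: "length xs = n" "length ys = n"
    using distinct_card[OF xs] distinct_card[OF ys] eq by (auto simp: n_def)
  define A where "A = mat n n (\<lambda>(i, j). f (xs ! i) (xs ! j))"
  define B where "B = mat n n (\<lambda>(i, j). f (ys ! i) (ys ! j))"
  define P where "P = mat n n (\<lambda>(i, j). of_bool (xs ! i = ys ! j) :: 'a)"
  define Q where "Q = mat n n (\<lambda>(i, j). of_bool (ys ! i = xs ! j) :: 'a)"
  have C: "A \<in> carrier_mat n n" "B \<in> carrier_mat n n" "P \<in> carrier_mat n n" "Q \<in> carrier_mat n n"
    by (auto simp: A_def B_def P_def Q_def)
  have sx: "(\<Sum>l = 0..<n. g (xs ! l)) = sum g (set xs)" for g :: "'v \<Rightarrow> 'a"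
    using sum_nth_distinct[OF xs] n by simp
  have sy: "(\<Sum>l = 0..<n. g (ys ! l)) = sum g (set xs)" for g :: "'v \<Rightarrow> 'a"
    using sum_nth_distinct[OF ys] n eq by simp
  have mem: "i < n \<Longrightarrow> xs ! i \<in> set xs" "i < n \<Longrightarrow> ys ! i \<in> set xs" for i
    using n eq by (metis nth_mem)+
  have PQ: "P * Q = 1\<^sub>m n"
  proof (rule eq_matI)
    fix i j assume ij: "i < dim_row (1\<^sub>m n :: 'a mat)" "j < dim_col (1\<^sub>m n :: 'a mat)"
    hence "(P * Q) $$ (i, j) = (\<Sum>l = 0..<n. of_bool (xs ! i = ys ! l) * of_bool (ys ! l = xs ! j))"
      by (simp add: P_def Q_def scalar_prod_def)
    also have "\<dots> = (\<Sum>u \<in> set xs. of_bool (xs ! i = u) * of_bool (u = xs ! j))"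
      by (rule sy)
    also have "\<dots> = (\<Sum>u \<in> set xs. if u = xs ! i then of_bool (xs ! i = xs ! j) else 0)"
      by (rule sum.cong) auto
    also have "\<dots> = of_bool (i = j)"
      using ij mem xs n by (simp add: nth_eq_iff_index_eq)
    finally show "(P * Q) $$ (i, j) = 1\<^sub>m n $$ (i, j)" using ij by simp
  qed (auto simp: P_def Q_def)
  have QP: "Q * P = 1\<^sub>m n"
    using mat_mult_left_right_inverse[OF C(3,4) PQ] .
  have PB: "(P * B) $$ (i, j) = f (xs ! i) (ys ! j)" if ij: "i < n" "j < n" for i j
  proof -
    have "(P * B) $$ (i, j) = (\<Sum>l = 0..<n. of_bool (xs ! i = ys ! l) * f (ys ! l) (ys ! j))"
      using ij by (simp add: P_def B_def scalar_prod_def)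
    also have "\<dots> = (\<Sum>u \<in> set xs. of_bool (xs ! i = u) * f u (ys ! j))"
      by (rule sy)
    also have "\<dots> = (\<Sum>u \<in> set xs. if u = xs ! i then f (xs ! i) (ys ! j) else 0)"
      by (rule sum.cong) auto
    also have "\<dots> = f (xs ! i) (ys ! j)" using ij mem by simp
    finally show ?thesis .
  qed
  have PBQ: "A = P * B * Q"
  proof (rule eq_matI)
    fix i j assume "i < dim_row (P * B * Q)" "j < dim_col (P * B * Q)"
    hence ij: "i < n" "j < n" by (auto simp: P_def Q_def)
    have "(P * B * Q) $$ (i, j) = (\<Sum>l = 0..<n. (P * B) $$ (i, l) * Q $$ (l, j))"
    proof -
      have "(M * Q) $$ (i, j) = (\<Sum>l = 0..<n. M $$ (i, l) * Q $$ (l, j))"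
        if "M \<in> carrier_mat n n" for M
        using that ij C(4) by (simp add: scalar_prod_def)
      from this[OF mult_carrier_mat[OF C(3,2)]] show ?thesis .
    qed
    also have "\<dots> = (\<Sum>l = 0..<n. f (xs ! i) (ys ! l) * of_bool (ys ! l = xs ! j))"
      using ij PB by (intro sum.cong) (auto simp: Q_def)
    also have "\<dots> = (\<Sum>u \<in> set xs. f (xs ! i) u * of_bool (u = xs ! j))"
      by (rule sy)
    also have "\<dots> = (\<Sum>u \<in> set xs. if u = xs ! j then f (xs ! i) (xs ! j) else 0)"
      by (rule sum.cong) auto
    also have "\<dots> = f (xs ! i) (xs ! j)" using ij mem by simp
    finally show "A $$ (i, j) = (P * B * Q) $$ (i, j)" using ij by (simp add: A_def)
  qed (auto simp: A_def P_def Q_def)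
  have "similar_mat_wit A B P Q"
    using C PQ QP PBQ by (auto simp: similar_mat_wit_def Let_def)
  from similar_mat_wit_kernel_dim[OF C(1) this] C show ?thesis
    unfolding n A_def B_def by (simp add: kernel_dim_def)
qed

lemma kernel_dim_reduced_mat:
  assumes "distinct vs" "distinct ws" "set vs = set ws"
  shows "kernel_dim (reduced_mat G vs T) = kernel_dim (reduced_mat G ws T)"
  unfolding reduced_mat_filter[OF assms(1)] reduced_mat_filter[OF assms(2)]
  by (rule kernel_dim_reorder) (use assms in auto)

lemma vertex_enum:
  assumes "finite (verts G)"
  shows "distinct (vertex_enum G)" "set (vertex_enum G) = verts G"
  using someI_ex[of "\<lambda>vs. distinct vs \<and> set vs = verts G"] finite_distinct_list[OF assms]
  unfolding vertex_enum_def by blast+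

lemma quotient_by:
  assumes "\<And>x. d * x = 0 \<Longrightarrow> x = 0"
  shows "quotient_by d (d * y) = y"
proof -
  have "z = y" if "d * z = d * y" for z
    using assms[of "z - y"] that by (simp add: algebra_simps)
  thus ?thesis unfolding quotient_by_def by (intro the_equality) auto
qed

end

theory Submission
  imports Defs "HOL-Library.Cardinality"
begin

text \<open>
  Split the sum over \<open>T\<close> into the part \<open>U\<close> of \<open>T\<close> among the twins \<open>S\<close> and the rest \<open>T'\<close>.
  If \<open>U \<noteq> S\<close>, then the equation of a twin outside \<open>U\<close> forces the entries of every kernel vector at the
  twins in \<open>U\<close> to vanish, and only the sum of the entries over \<open>S - U\<close> matters for the other
  equations; so the nullity is \<open>card (S - U) - 1\<close> plus the nullity for a single twin outside \<open>T\<close>.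
  If \<open>U = S\<close>, then the entries at all twins agree, and as \<open>card S\<close> is odd, their sum is this common
  value; so the nullity is the one for a single twin inside \<open>T\<close>. The contributions of the
  \<open>U \<noteq> S\<close> add up to the new weight \<open>\<alpha>'\<close> by expanding \<open>\<Prod>(\<alpha> d + \<beta>)\<close>, and \<open>U = S\<close> gives \<open>\<beta>'\<close>.
  Nullities are compared by counting kernel vectors over the two-element field.
\<close>

section \<open>Counting kernel vectors over a finite field\<close>

text \<open>Every kernel vector has unique coordinates in a finite basis. Since the base of the
  power is at least 2, nullities can be compared through these cardinalities.\<close>

lemma card_mat_kernel:
  fixes A :: "'a :: {field, finite} mat"
  shows "card (mat_kernel A) = CARD('a) ^ kernel_dim A"
proof -
  interpret kernel "dim_row A" "dim_col A" A by unfold_locales auto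
  obtain B where B: "finite B" "basis B"
    using kernel_basis_exists[OF A] by blast
  have BA: "B \<subseteq> mat_kernel A"
    using B(2) by (simp add: Ker.basis_def)
  \<comment> \<open>Extensionality on \<open>B\<close> makes the coefficient function unique and the
    set of such functions finite.\<close>
  have ex1: "\<exists>!a. a \<in> B \<rightarrow>\<^sub>E UNIV \<and> lincomb a B = x" if "x \<in> mat_kernel A" for x
    using Ker.basis_criterion[OF B(1) BA] B(2) that by simp
  have "bij_betw (\<lambda>a. lincomb a B) (B \<rightarrow>\<^sub>E UNIV) (mat_kernel A)"
    unfolding bij_betw_def
  proof
    have lin: "lincomb a B \<in> mat_kernel A" for a
      using Ker.lincomb_closed[OF BA] by auto
    show "inj_on (\<lambda>a. lincomb a B) (B \<rightarrow>\<^sub>E UNIV)"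
      using ex1[OF lin] by (auto intro!: inj_onI)
    show "(\<lambda>a. lincomb a B) ` (B \<rightarrow>\<^sub>E UNIV) = mat_kernel A"
      using lin ex1 by blast
  qed
  from bij_betw_same_card[OF this] have "card (mat_kernel A) = CARD('a) ^ card B"
    using B(1) by (simp add: card_funcsetE)
  with Ker.dim_basis[OF B] show ?thesis by simp
qed

text \<open>The kernel with coordinates indexed by \<open>I\<close> itself, so that no enumeration
  is involved. Extensional functions make each vector occur exactly once.\<close>

definition null_vectors :: "'v set \<Rightarrow> ('v \<Rightarrow> 'v \<Rightarrow> 'a :: comm_ring_1) \<Rightarrow> ('v \<Rightarrow> 'a) set" where
  "null_vectors I f = {x \<in> I \<rightarrow>\<^sub>E UNIV. \<forall>u \<in> I. (\<Sum>w \<in> I. f u w * x w) = 0}"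

text \<open>Reading off entries along \<open>xs\<close> identifies functions on
  \<open>set xs\<close> with vectors, and row sums with matrix-vector products.\<close>

lemma card_null_vectors:
  fixes f :: "'v \<Rightarrow> 'v \<Rightarrow> 'a :: {field, finite}"
  assumes xs: "distinct xs"
  shows "card (null_vectors (set xs) f) =
    CARD('a) ^ kernel_dim (mat (length xs) (length xs) (\<lambda>(i, j). f (xs ! i) (xs ! j)))"
proof -
  define n where "n = length xs"
  define A where "A = mat n n (\<lambda>(i, j). f (xs ! i) (xs ! j))"
  define F where "F = (\<lambda>x :: 'v \<Rightarrow> 'a. vec n (\<lambda>i. x (xs ! i)))"
  \<comment> \<open>The inverse of \<open>F\<close>: the position of \<open>u\<close> in
    \<open>xs\<close> is unique because \<open>xs\<close> is distinct.\<close>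
  define H where "H = (\<lambda>y. \<lambda>u \<in> set xs. y $ (THE i. i < n \<and> xs ! i = u) :: 'a)"
  have the: "(THE i. i < n \<and> xs ! i = xs ! j) = j" if "j < n" for j
    using that xs by (auto simp: n_def nth_eq_iff_index_eq)
  have mult: "(A *\<^sub>v F x) $ i = (\<Sum>w \<in> set xs. f (xs ! i) w * x w)" if "i < n" for x i
    using that sum_nth_distinct[OF xs, of "\<lambda>w. f (xs ! i) w * x w"]
    by (simp add: A_def F_def n_def scalar_prod_def)
  have ker: "F x \<in> mat_kernel A \<longleftrightarrow> (\<forall>u \<in> set xs. (\<Sum>w \<in> set xs. f u w * x w) = 0)" for x
  proof -
    have "F x \<in> mat_kernel A \<longleftrightarrow> A *\<^sub>v F x = 0\<^sub>v n"
      by (simp add: mat_kernel_def A_def F_def)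
    also have "\<dots> \<longleftrightarrow> (\<forall>i < n. (A *\<^sub>v F x) $ i = 0)"
      by (auto simp: vec_eq_iff A_def)
    also have "\<dots> \<longleftrightarrow> (\<forall>i < n. (\<Sum>w \<in> set xs. f (xs ! i) w * x w) = 0)"
      using mult by simp
    also have "\<dots> \<longleftrightarrow> (\<forall>u \<in> set xs. (\<Sum>w \<in> set xs. f u w * x w) = 0)"
      unfolding all_set_conv_all_nth n_def ..
    finally show ?thesis .
  qed
  have HF: "H (F x) = x" if "x \<in> set xs \<rightarrow>\<^sub>E UNIV" for x
  proof
    fix u
    show "H (F x) u = x u"
    proof (cases "u \<in> set xs")
      case True
      then obtain j where "j < n" "u = xs ! j" by (auto simp: in_set_conv_nth n_def)
      with True show ?thesis by (simp add: H_def the) (simp add: F_def)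
    next
      case False
      with that show ?thesis by (auto simp: H_def PiE_def extensional_def)
    qed
  qed
  have FH: "F (H y) = y" if "y \<in> carrier_vec n" for y
    using that by (intro eq_vecI) (auto simp: F_def H_def the[unfolded n_def] n_def)
  have mk: "mat_kernel A \<subseteq> carrier_vec n"
    by (auto simp: mat_kernel_def A_def)
  have "bij_betw F (null_vectors (set xs) f) (mat_kernel A)"
  proof (rule bij_betw_byWitness[of _ H])
    show "H ` mat_kernel A \<subseteq> null_vectors (set xs) f"
    proof safe
      fix y assume y: "y \<in> mat_kernel A"
      with mk have "F (H y) = y" by (intro FH) auto
      with y have "F (H y) \<in> mat_kernel A" by simp
      moreover have "H y \<in> set xs \<rightarrow>\<^sub>E UNIV" by (auto simp: H_def)
      ultimately show "H y \<in> null_vectors (set xs) f"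
        by (simp add: ker null_vectors_def)
    qed
  qed (use HF FH ker mk in \<open>auto simp: null_vectors_def\<close>)
  from bij_betw_same_card[OF this] show ?thesis
    unfolding card_mat_kernel A_def n_def .
qed

section \<open>Kernels of matrices with a block of twins\<close>

text \<open>
  The kernel of a matrix whose block on \<open>S\<close> is diagonal with ones exactly at \<open>U\<close>, and in which all
  rows and columns of \<open>S\<close> have the same entries \<open>r\<close> and \<open>c\<close> at the other indices \<open>W\<close>.
\<close>

definition twin_null_vectors ::
  "'v set \<Rightarrow> 'v set \<Rightarrow> 'v set \<Rightarrow> ('v \<Rightarrow> 'a) \<Rightarrow> ('v \<Rightarrow> 'a) \<Rightarrow> ('v \<Rightarrow> 'v \<Rightarrow> 'a :: comm_ring_1) \<Rightarrow> ('v \<Rightarrow> 'a) set"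
  where "twin_null_vectors S U W r c M = {x \<in> S \<union> W \<rightarrow>\<^sub>E UNIV.
    (\<forall>s \<in> S. of_bool (s \<in> U) * x s + (\<Sum>w \<in> W. r w * x w) = 0) \<and>
    (\<forall>u \<in> W. c u * (\<Sum>s \<in> S. x s) + (\<Sum>w \<in> W. M u w * x w) = 0)}"

lemma null_vectors_eq_twin_null_vectors:
  assumes "finite S" "finite W" "S \<inter> W = {}"
    and diag: "\<And>s t. s \<in> S \<Longrightarrow> t \<in> S \<Longrightarrow> f s t = of_bool (s = t \<and> s \<in> U)"
    and row: "\<And>s w. s \<in> S \<Longrightarrow> w \<in> W \<Longrightarrow> f s w = r w"
    and col: "\<And>s w. s \<in> S \<Longrightarrow> w \<in> W \<Longrightarrow> f w s = c w"
  shows "null_vectors (S \<union> W) f = twin_null_vectors S U W r c f"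
proof -
  have 1: "(\<Sum>w \<in> S \<union> W. f s w * x w) = of_bool (s \<in> U) * x s + (\<Sum>w \<in> W. r w * x w)"
    if "s \<in> S" for s x
  proof -
    have "(\<Sum>t \<in> S. f s t * x t) = (\<Sum>t \<in> S. if t = s then of_bool (s \<in> U) * x s else 0)"
      using that diag by (intro sum.cong) auto
    also have "\<dots> = of_bool (s \<in> U) * x s" using that assms(1) by simp
    finally have "(\<Sum>t \<in> S. f s t * x t) = of_bool (s \<in> U) * x s" .
    moreover have "(\<Sum>w \<in> W. f s w * x w) = (\<Sum>w \<in> W. r w * x w)"
      using that row by (intro sum.cong) auto
    ultimately show ?thesis using assms(1-3) by (simp add: sum.union_disjoint)
  qed
  have 2: "(\<Sum>w \<in> S \<union> W. f u w * x w) = c u * (\<Sum>s \<in> S. x s) + (\<Sum>w \<in> W. f u w * x w)"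
    if "u \<in> W" for u x
  proof -
    have "(\<Sum>t \<in> S. f u t * x t) = c u * (\<Sum>s \<in> S. x s)"
      using that col by (simp add: sum_distrib_left)
    thus ?thesis using assms(1-3) by (simp add: sum.union_disjoint)
  qed
  show ?thesis
    unfolding null_vectors_def twin_null_vectors_def ball_Un using 1 2 by auto
qed

text \<open>All equations at \<open>S\<close> have the form \<open>x s + C = 0\<close> with the same
  \<open>C\<close>, so a solution is constant on \<open>S\<close>. Restriction to
  \<open>{a} \<union> W\<close> is then a bijection, and its inverse copies the entry at
  \<open>a\<close> to all of \<open>S\<close>.\<close>

lemma card_twin_null_vectors_all:
  fixes r c :: "'v \<Rightarrow> 'a :: comm_ring_1"
  assumes "finite S" "S \<inter> W = {}" "a \<in> S" and odd: "of_nat (card S) = (1 :: 'a)"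
  shows "card (twin_null_vectors S S W r c M) = card (twin_null_vectors {a} {a} W r c M)"
proof -
  define F where "F = (\<lambda>x :: 'v \<Rightarrow> 'a. restrict x ({a} \<union> W))"
  define H where "H = (\<lambda>y :: 'v \<Rightarrow> 'a. \<lambda>u \<in> S \<union> W. if u \<in> S then y a else y u)"
  have W: "w \<notin> S" if "w \<in> W" for w using that assms(2) by auto
  have FW: "(\<Sum>w \<in> W. g w * F x w) = (\<Sum>w \<in> W. g w * x w)" for g x
    by (intro sum.cong) (auto simp: F_def)
  have HW: "(\<Sum>w \<in> W. g w * H x w) = (\<Sum>w \<in> W. g w * x w)" for g x
    using W by (intro sum.cong) (auto simp: H_def)
  have Fa: "F x a = x a" for x by (simp add: F_def)
  have HS: "H y s = y a" if "s \<in> S" for y s using that by (simp add: H_def)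
  \<comment> \<open>The sum is \<open>card S\<close> copies of \<open>y a\<close>, and
    \<open>card S\<close> is 1 in the ring, so the equations at \<open>W\<close> are
    preserved.\<close>
  have sumH: "(\<Sum>s \<in> S. H y s) = y a" for y
    using HS odd by simp
  have const: "x s = x a" if "x \<in> twin_null_vectors S S W r c M" "s \<in> S" for x s
  proof -
    have "x t + (\<Sum>w \<in> W. r w * x w) = 0" if "t \<in> S" for t
      using \<open>x \<in> _\<close> that by (simp add: twin_null_vectors_def)
    from this[OF that(2)] this[OF assms(3)] show ?thesis
      by (metis add_right_cancel)
  qed
  have sum: "(\<Sum>s \<in> S. x s) = x a" if "x \<in> twin_null_vectors S S W r c M" for x
    using const[OF that] odd by simp
  have "bij_betw F (twin_null_vectors S S W r c M) (twin_null_vectors {a} {a} W r c M)"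
  proof (rule bij_betw_byWitness[of _ H])
    show "\<forall>x \<in> twin_null_vectors S S W r c M. H (F x) = x"
    proof
      fix x assume x: "x \<in> twin_null_vectors S S W r c M"
      hence "x \<in> S \<union> W \<rightarrow>\<^sub>E UNIV" by (simp add: twin_null_vectors_def)
      with const[OF x] show "H (F x) = x"
        by (auto simp: fun_eq_iff H_def F_def PiE_def extensional_def)
    qed
    show "\<forall>y \<in> twin_null_vectors {a} {a} W r c M. F (H y) = y"
      using assms(3) W
      by (auto simp: fun_eq_iff H_def F_def PiE_def extensional_def twin_null_vectors_def)
    show "F ` twin_null_vectors S S W r c M \<subseteq> twin_null_vectors {a} {a} W r c M"
    proof safe
      fix x assume x: "x \<in> twin_null_vectors S S W r c M"
      show "F x \<in> twin_null_vectors {a} {a} W r c M"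
        using x sum[OF x] assms(3)
        by (simp add: twin_null_vectors_def FW Fa) (simp add: F_def)
    qed
    show "H ` twin_null_vectors {a} {a} W r c M \<subseteq> twin_null_vectors S S W r c M"
    proof safe
      fix y assume y: "y \<in> twin_null_vectors {a} {a} W r c M"
      show "H y \<in> twin_null_vectors S S W r c M"
        unfolding twin_null_vectors_def mem_Collect_eq HW sumH
      proof (intro conjI)
        show "H y \<in> S \<union> W \<rightarrow>\<^sub>E UNIV" by (simp add: H_def)
      qed (use y HS in \<open>auto simp: twin_null_vectors_def\<close>)
    qed
  qed
  thus ?thesis by (rule bij_betw_same_card)
qed

text \<open>A solution vanishes on \<open>U\<close>. On \<open>S - U\<close> only its total enters
  the other equations, so this total acts as the entry of a single twin with diagonal entry 0, while
  all but one of the entries on \<open>S - U\<close> are free.\<close>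

lemma card_twin_null_vectors_proper:
  fixes r c :: "'v \<Rightarrow> 'a :: {comm_ring_1, finite}"
  assumes "finite S" "S \<inter> W = {}" "a \<in> S" "U \<subset> S"
  shows "card (twin_null_vectors S U W r c M) =
    CARD('a) ^ (card (S - U) - 1) * card (twin_null_vectors {a} {} W r c M)"
proof -
  \<comment> \<open>The diagonal entry at \<open>p\<close> is 0, so its equation says that the
    common sum over \<open>W\<close> is 0. The entry at \<open>p\<close> will be the dependent one;
    those at \<open>P\<close> are the free ones.\<close>
  obtain p where p: "p \<in> S" "p \<notin> U" using assms(4) by blast
  define P where "P = S - U - {p}"
  have SU: "S - U = insert p P" "p \<notin> P" "P \<subseteq> S" "P \<inter> U = {}"
    using p by (auto simp: P_def)
  have finP: "finite P" using assms(1) by (simp add: P_def)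
  \<comment> \<open>\<open>F\<close> records the free entries and places the total over
    \<open>S\<close> at \<open>a\<close>; \<open>H\<close> recovers the entry at \<open>p\<close>
    from that total.\<close>
  define F where "F = (\<lambda>x :: 'v \<Rightarrow> 'a. (restrict x P, \<lambda>u \<in> {a} \<union> W. if u = a then \<Sum>s \<in> S. x s else x u))"
  define H where "H = (\<lambda>(z, y :: 'v \<Rightarrow> 'a). \<lambda>u \<in> S \<union> W. if u \<in> P then z u
     else if u = p then y a - (\<Sum>s \<in> P. z s) else if u \<in> U then 0 else y u)"
  have W: "w \<notin> S" if "w \<in> W" for w using that assms(2) by auto
  have W': "w \<notin> P" "w \<noteq> p" "w \<notin> U" "w \<noteq> a" if "w \<in> W" for w
    using W[OF that] SU p assms(3,4) by auto
  have FW: "(\<Sum>w \<in> W. g w * snd (F x) w) = (\<Sum>w \<in> W. g w * x w)" for g x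
    using W' by (intro sum.cong) (auto simp: F_def)
  have HW: "(\<Sum>w \<in> W. g w * H (z, y) w) = (\<Sum>w \<in> W. g w * y w)" for g z y
    using W' by (intro sum.cong) (auto simp: H_def)
  have Fa: "snd (F x) a = (\<Sum>s \<in> S. x s)" for x by (simp add: F_def)
  have sumS: "(\<Sum>s \<in> S. x s) = x p + (\<Sum>s \<in> P. x s)" if "\<And>s. s \<in> U \<Longrightarrow> x s = 0" for x :: "'v \<Rightarrow> 'a"
  proof -
    have "(\<Sum>s \<in> S. x s) = (\<Sum>s \<in> S - U. x s)"
      using assms(1) that by (intro sum.mono_neutral_right) auto
    thus ?thesis using SU finP by simp
  qed
  have HU: "H (z, y) s = 0" if "s \<in> U" for z y s
    using that p SU assms(4) by (auto simp: H_def)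
  have HP: "H (z, y) s = z s" if "s \<in> P" for z y s
    using that SU(3) by (auto simp: H_def)
  have Hp: "H (z, y) p = y a - (\<Sum>s \<in> P. z s)" for z y
    using p SU(2) by (simp add: H_def)
  have sumH: "(\<Sum>s \<in> S. H (z, y) s) = y a" for z y
    using HP by (subst sumS) (auto simp: HU Hp)
  \<comment> \<open>The equations of \<open>p\<close> and \<open>s\<close> differ only by the term
    \<open>x s\<close>.\<close>
  have 0: "x s = 0" if x: "x \<in> twin_null_vectors S U W r c M" "s \<in> U" for x s
  proof -
    have "of_bool (p \<in> U) * x p + (\<Sum>w \<in> W. r w * x w) = 0"
      using x p(1) unfolding twin_null_vectors_def by blast
    moreover have "of_bool (s \<in> U) * x s + (\<Sum>w \<in> W. r w * x w) = 0"
      using x assms(4) unfolding twin_null_vectors_def by blast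
    ultimately show ?thesis using p(2) x(2) by simp
  qed
  have row0: "(\<Sum>w \<in> W. r w * x w) = 0" if "x \<in> twin_null_vectors S U W r c M" for x
  proof -
    have "of_bool (p \<in> U) * x p + (\<Sum>w \<in> W. r w * x w) = 0"
      using that p(1) unfolding twin_null_vectors_def by blast
    thus ?thesis using p(2) by simp
  qed
  have "bij_betw F (twin_null_vectors S U W r c M)
          ((P \<rightarrow>\<^sub>E UNIV) \<times> twin_null_vectors {a} {} W r c M)"
  proof (rule bij_betw_byWitness[of _ H])
    show "\<forall>x \<in> twin_null_vectors S U W r c M. H (F x) = x"
    proof (intro ballI ext)
      fix x u assume x: "x \<in> twin_null_vectors S U W r c M"
      hence xE: "x \<in> S \<union> W \<rightarrow>\<^sub>E UNIV" by (simp add: twin_null_vectors_def)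
      have xs: "(\<Sum>s \<in> S. x s) = x p + (\<Sum>s \<in> P. x s)" by (rule sumS) (rule 0[OF x])
      consider "u \<in> P" | "u = p" | "u \<in> U" | "u \<in> W" | "u \<notin> S \<union> W"
        using SU by blast
      thus "H (F x) u = x u"
      proof cases
        case 1 thus ?thesis using HP by (simp add: F_def)
      next
        case 2 thus ?thesis using xs by (simp add: F_def Hp)
      next
        case 3 thus ?thesis using 0[OF x] HU by (simp add: F_def)
      next
        case 4 thus ?thesis using W' by (simp add: F_def H_def)
      next
        case 5 thus ?thesis using xE by (auto simp: F_def H_def PiE_def extensional_def)
      qed
    qed
    show "\<forall>y \<in> (P \<rightarrow>\<^sub>E UNIV) \<times> twin_null_vectors {a} {} W r c M. F (H y) = y"
    proof clarify
      fix z y assume z: "z \<in> P \<rightarrow>\<^sub>E (UNIV :: 'a set)" and y: "y \<in> twin_null_vectors {a} {} W r c M"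
      have "restrict (H (z, y)) P = z"
        using z HP by (auto simp: fun_eq_iff PiE_def extensional_def)
      moreover have "(\<lambda>u \<in> {a} \<union> W. if u = a then \<Sum>s \<in> S. H (z, y) s else H (z, y) u) = y"
      proof
        fix u
        have "y \<in> {a} \<union> W \<rightarrow>\<^sub>E UNIV" using y unfolding twin_null_vectors_def by blast
        thus "(\<lambda>u \<in> {a} \<union> W. if u = a then \<Sum>s \<in> S. H (z, y) s else H (z, y) u) u = y u"
          unfolding sumH using W' by (auto simp: H_def PiE_def extensional_def)
      qed
      ultimately show "F (H (z, y)) = (z, y)" unfolding F_def by (rule arg_cong2)
    qed
    show "F ` twin_null_vectors S U W r c M \<subseteq> (P \<rightarrow>\<^sub>E UNIV) \<times> twin_null_vectors {a} {} W r c M"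
    proof (rule image_subsetI)
      fix x assume x: "x \<in> twin_null_vectors S U W r c M"
      have "snd (F x) \<in> twin_null_vectors {a} {} W r c M"
        unfolding twin_null_vectors_def mem_Collect_eq FW
      proof (intro conjI)
        show "snd (F x) \<in> {a} \<union> W \<rightarrow>\<^sub>E UNIV" by (simp add: F_def)
      qed (use x row0[OF x] in \<open>auto simp: twin_null_vectors_def Fa\<close>)
      moreover have "fst (F x) \<in> P \<rightarrow>\<^sub>E UNIV" by (simp add: F_def)
      ultimately show "F x \<in> (P \<rightarrow>\<^sub>E UNIV) \<times> twin_null_vectors {a} {} W r c M"
        by (simp add: mem_Times_iff)
    qed
    show "H ` ((P \<rightarrow>\<^sub>E UNIV) \<times> twin_null_vectors {a} {} W r c M) \<subseteq> twin_null_vectors S U W r c M"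
    proof clarify
      fix z y assume y: "y \<in> twin_null_vectors {a} {} W r c M"
      show "H (z, y) \<in> twin_null_vectors S U W r c M"
        unfolding twin_null_vectors_def mem_Collect_eq HW sumH
      proof (intro conjI)
        show "H (z, y) \<in> S \<union> W \<rightarrow>\<^sub>E UNIV" by (simp add: H_def)
      qed (use y HU in \<open>auto simp: twin_null_vectors_def\<close>)
    qed
  qed
  \<comment> \<open>The exponent is \<open>card P\<close>, one less than \<open>card (S - U)\<close>
    because \<open>p\<close> was removed.\<close>
  from bij_betw_same_card[OF this] show ?thesis
    using finP SU by (simp add: card_cartesian_product card_funcsetE)
qed

section \<open>Nullities of the toggled adjacency matrices\<close>

lemma UNIV_bit: "UNIV = {0, 1 :: bit}"
  by (auto simp: bit_not_one_iff)

instance bit :: finite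
  by standard (simp add: UNIV_bit)

lemma CARD_bit [simp]: "CARD(bit) = 2"
  by (simp add: UNIV_bit)

lemma adjacent_sym: "adjacent G u w = adjacent G w u"
  by (auto simp: adjacent_def insert_commute)

text \<open>This is the function \<open>f\<close> of \<open>reduced_mat_filter\<close>: the entries
  of \<open>toggled_mat\<close> indexed by vertices instead of positions.\<close>

definition toggled_entry :: "('v, 'e, 'r) wm_graph \<Rightarrow> 'v set \<Rightarrow> 'v \<Rightarrow> 'v \<Rightarrow> bit" where
  "toggled_entry G T u w =
     (if u = w then of_bool (looped G u) + of_bool (u \<in> T) else of_bool (adjacent G u w))"

definition surviving :: "('v, 'e, 'r) wm_graph \<Rightarrow> 'v set \<Rightarrow> 'v set" where
  "surviving G T = {u \<in> verts G. \<not> (u \<in> marked G \<and> toggled_entry G T u u = 0)}"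

lemma card_null_vectors_toggled_entry:
  assumes "finite (verts G)"
  shows "card (null_vectors (surviving G T) (toggled_entry G T)) =
    2 ^ kernel_dim (reduced_mat G (vertex_enum G) T)"
proof -
  let ?us = "filter (\<lambda>u. \<not> (u \<in> marked G \<and> toggled_entry G T u u = 0)) (vertex_enum G)"
  have "set ?us = surviving G T" "distinct ?us"
    using vertex_enum[OF assms] by (auto simp: surviving_def)
  moreover have "reduced_mat G (vertex_enum G) T =
      mat (length ?us) (length ?us) (\<lambda>(i, j). toggled_entry G T (?us ! i) (?us ! j))"
    by (simp only: reduced_mat_filter[OF vertex_enum(1)[OF assms]] toggled_entry_def)
  ultimately show ?thesis
    using card_null_vectors[of ?us "toggled_entry G T"] by simp
qed

text \<open>Adjacency is compared only at vertices outside the whole class. A singleton class is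
  also an instance, so \<open>power_nullity\<close> serves both \<open>G\<close> with
  \<open>S\<close> and the merged graph with \<open>{a}\<close>.\<close>

locale twin_class =
  fixes G :: "('v, 'e, 'r :: comm_ring_1) wm_graph" and S :: "'v set"
  assumes finite_verts: "finite (verts G)"
    and S_verts: "S \<subseteq> verts G"
    and S_unmarked: "S \<inter> marked G = {}"
    and S_unlooped: "\<And>s. s \<in> S \<Longrightarrow> \<not> looped G s"
    and S_nonadjacent: "\<And>s t. s \<in> S \<Longrightarrow> t \<in> S \<Longrightarrow> \<not> adjacent G s t"
    and S_twins: "\<And>s t w. s \<in> S \<Longrightarrow> t \<in> S \<Longrightarrow> w \<in> verts G - S \<Longrightarrow> adjacent G s w = adjacent G t w"
begin

text \<open>On the right, \<open>U\<close> enters only as the set of twins with diagonal entry 1;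
  everything else depends on \<open>T\<close> alone. This allows different \<open>U\<close> to be
  compared for a fixed \<open>T\<close>. Symmetry of adjacency makes the common row and column
  equal.\<close>

lemma power_nullity:
  assumes "a \<in> S" "U \<subseteq> S" "T \<subseteq> verts G - S"
  shows "2 ^ kernel_dim (reduced_mat G (vertex_enum G) (U \<union> T)) =
    card (twin_null_vectors S U (surviving G T - S) (toggled_entry G T a) (toggled_entry G T a)
      (toggled_entry G T))"
proof -
  let ?f = "toggled_entry G (U \<union> T)" and ?g = "toggled_entry G T" and ?W = "surviving G T - S"
  have fg: "?f u w = ?g u w" if "u \<notin> S" for u w
    using that assms by (auto simp: toggled_entry_def)
  \<comment> \<open>Twins are unmarked, so their rows and columns are never removed; away from
    \<open>S\<close> the diagonal does not see \<open>U\<close>.\<close>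
  have sur: "surviving G (U \<union> T) = S \<union> ?W"
  proof (rule Set.set_eqI)
    fix u
    show "u \<in> surviving G (U \<union> T) \<longleftrightarrow> u \<in> S \<union> ?W"
      using S_verts S_unmarked fg[of u u] by (cases "u \<in> S") (auto simp: surviving_def)
  qed
  have finite: "finite S" "finite ?W"
    using finite_verts S_verts by (auto simp: surviving_def intro: finite_subset)
  have "null_vectors (S \<union> ?W) ?f = twin_null_vectors S U ?W (?g a) (?g a) ?f"
  proof (rule null_vectors_eq_twin_null_vectors)
    fix s t assume "s \<in> S" "t \<in> S"
    thus "?f s t = of_bool (s = t \<and> s \<in> U)"
      using assms S_unlooped S_nonadjacent by (auto simp: toggled_entry_def)
  next
    fix s w assume sw: "s \<in> S" "w \<in> ?W"
    hence w: "w \<in> verts G - S" by (auto simp: surviving_def)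
    hence "s \<noteq> w" "a \<noteq> w" using sw assms(1) by auto
    thus "?f s w = ?g a w" "?f w s = ?g a w"
      using S_twins[OF sw(1) assms(1) w] by (simp_all add: toggled_entry_def adjacent_sym[of G w s])
  qed (use finite in auto)
  also have "\<dots> = twin_null_vectors S U ?W (?g a) (?g a) ?g"
    unfolding twin_null_vectors_def by (simp add: fg)
  finally show ?thesis
    using card_null_vectors_toggled_entry[OF finite_verts, of "U \<union> T"] by (simp only: sur)
qed

end

section \<open>Splitting the bracket sum and expanding the weights\<close>

lemma sum_Pow_Un_disjoint:
  assumes "finite A" "finite B" "A \<inter> B = {}"
  shows "sum g (Pow (A \<union> B)) = (\<Sum>T \<in> Pow B. \<Sum>U \<in> Pow A. g (U \<union> T))"
proof -
  have "sum g (Pow (A \<union> B)) = (\<Sum>(T, U) \<in> Pow B \<times> Pow A. g (U \<union> T))"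
    by (rule sum.reindex_bij_witness[of _ "\<lambda>(T, U). U \<union> T" "\<lambda>T. (T \<inter> B, T \<inter> A)"])
       (use assms(3) in \<open>auto intro: arg_cong[of _ _ g]\<close>)
  thus ?thesis by (simp add: sum.cartesian_product)
qed

text \<open>The weights outside \<open>S\<close> factor out, so two brackets with the same outer
  vertices and weights can be compared through their inner sums over \<open>U\<close>.\<close>

lemma bracket_split:
  assumes "finite (verts G)" "S \<subseteq> verts G"
  shows "bracket d G = d ^ free_loops G * (\<Sum>T \<in> Pow (verts G - S).
    (\<Prod>v \<in> verts G - S - T. alpha G v) * (\<Prod>t \<in> T. beta G t) *
    (\<Sum>U \<in> Pow S. (\<Prod>v \<in> S - U. alpha G v) * (\<Prod>t \<in> U. beta G t) *
       d ^ kernel_dim (reduced_mat G (vertex_enum G) (U \<union> T))))"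
proof -
  let ?\<nu> = "\<lambda>T. kernel_dim (reduced_mat G (vertex_enum G) T)"
  have fin: "finite S" "finite (verts G - S)" using assms finite_subset by auto
  have V: "verts G = S \<union> (verts G - S)" using assms(2) by auto
  have "(\<Sum>T \<in> Pow (verts G). (\<Prod>v \<in> verts G - T. alpha G v) * (\<Prod>t \<in> T. beta G t) * d ^ ?\<nu> T) =
    (\<Sum>T \<in> Pow (verts G - S). \<Sum>U \<in> Pow S. (\<Prod>v \<in> verts G - (U \<union> T). alpha G v) *
       (\<Prod>t \<in> U \<union> T. beta G t) * d ^ ?\<nu> (U \<union> T))"
    by (subst V, rule sum_Pow_Un_disjoint[OF fin Diff_disjoint])
  also have "\<dots> = (\<Sum>T \<in> Pow (verts G - S). \<Sum>U \<in> Pow S.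
      (\<Prod>v \<in> verts G - S - T. alpha G v) * (\<Prod>t \<in> T. beta G t) *
      ((\<Prod>v \<in> S - U. alpha G v) * (\<Prod>t \<in> U. beta G t) * d ^ ?\<nu> (U \<union> T)))"
  proof (intro sum.cong refl)
    fix T U assume TU: "T \<in> Pow (verts G - S)" "U \<in> Pow S"
    have "finite T" "finite U" "T \<inter> U = {}"
      using TU fin by (auto intro: finite_subset)
    hence "(\<Prod>t \<in> U \<union> T. beta G t) = (\<Prod>t \<in> U. beta G t) * (\<Prod>t \<in> T. beta G t)"
      by (intro prod.union_disjoint) auto
    moreover have "verts G - (U \<union> T) = (S - U) \<union> (verts G - S - T)"
      using TU assms(2) by auto
    hence "(\<Prod>v \<in> verts G - (U \<union> T). alpha G v) =
        (\<Prod>v \<in> S - U. alpha G v) * (\<Prod>v \<in> verts G - S - T. alpha G v)"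
      using fin by (simp only:) (intro prod.union_disjoint, auto)
    ultimately show "(\<Prod>v \<in> verts G - (U \<union> T). alpha G v) * (\<Prod>t \<in> U \<union> T. beta G t) * d ^ ?\<nu> (U \<union> T) =
      (\<Prod>v \<in> verts G - S - T. alpha G v) * (\<Prod>t \<in> T. beta G t) *
      ((\<Prod>v \<in> S - U. alpha G v) * (\<Prod>t \<in> U. beta G t) * d ^ ?\<nu> (U \<union> T))"
      by (simp add: mult_ac)
  qed
  finally show ?thesis by (simp add: bracket_def sum_distrib_left)
qed

text \<open>In the expansion of the product, \<open>U = S\<close> gives the product of the \<beta>
  weights, and every other term has at least one factor \<open>d\<close> to take out. The sum on the
  left is thus an explicit quotient, the new \<alpha> weight.\<close>

lemma mult_sum_psubsets:
  fixes d :: "'r :: comm_ring_1"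
  assumes "finite S"
  shows "d * (\<Sum>U \<in> Pow S - {S}. (\<Prod>v \<in> S - U. \<alpha> v) * (\<Prod>t \<in> U. \<beta> t) * d ^ (card (S - U) - 1)) =
    (\<Prod>v \<in> S. \<alpha> v * d + \<beta> v) - (\<Prod>v \<in> S. \<beta> v)"
proof -
  have "(\<Prod>v \<in> S. \<beta> v + \<alpha> v * d) = (\<Sum>U \<in> Pow S. (\<Prod>t \<in> U. \<beta> t) * (\<Prod>v \<in> S - U. \<alpha> v * d))"
    by (rule prod_add[OF assms])
  also have "\<dots> = (\<Prod>t \<in> S. \<beta> t) + (\<Sum>U \<in> Pow S - {S}. (\<Prod>t \<in> U. \<beta> t) * (\<Prod>v \<in> S - U. \<alpha> v * d))"
    using assms by (subst sum.remove[of _ S]) auto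
  also have "(\<Sum>U \<in> Pow S - {S}. (\<Prod>t \<in> U. \<beta> t) * (\<Prod>v \<in> S - U. \<alpha> v * d)) =
      d * (\<Sum>U \<in> Pow S - {S}. (\<Prod>v \<in> S - U. \<alpha> v) * (\<Prod>t \<in> U. \<beta> t) * d ^ (card (S - U) - 1))"
    unfolding sum_distrib_left
  proof (intro sum.cong refl)
    fix U assume "U \<in> Pow S - {S}"
    hence "S - U \<noteq> {}" "finite (S - U)" using assms by auto
    \<comment> \<open>\<open>S - U\<close> is nonempty, so the truncated subtraction is
      exact.\<close>
    hence "card (S - U) = Suc (card (S - U) - 1)" by (simp add: card_gt_0_iff)
    hence "d ^ card (S - U) = d * d ^ (card (S - U) - 1)" by (metis power_Suc)
    thus "(\<Prod>t \<in> U. \<beta> t) * (\<Prod>v \<in> S - U. \<alpha> v * d) =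
        d * ((\<Prod>v \<in> S - U. \<alpha> v) * (\<Prod>t \<in> U. \<beta> t) * d ^ (card (S - U) - 1))"
      by (simp add: prod.distrib mult_ac)
  qed
  finally show ?thesis by (simp add: add.commute)
qed

section \<open>Deleting and merging the twins\<close>

lemma foldl_del_vertex:
  "foldl del_vertex G xs = G\<lparr>verts := verts G - set xs,
     edges := {e \<in> edges G. ends G e \<inter> set xs = {}}, marked := marked G - set xs\<rparr>"
proof (induction xs arbitrary: G)
  case (Cons x xs)
  have "{e \<in> edges G. x \<notin> ends G e \<and> ends G e \<inter> set xs = {}} =
      {e \<in> edges G. ends G e \<inter> set (x # xs) = {}}" by auto
  moreover have "A - {x} - set xs = A - set (x # xs)" for A by auto
  ultimately show ?case unfolding foldl_Cons Cons.IH by (simp add: del_vertex_def)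
qed simp

lemma looped_foldl_del_vertex:
  assumes "u \<notin> set xs"
  shows "looped (foldl del_vertex G xs) u = looped G u"
  using assms by (auto simp: foldl_del_vertex looped_def)

lemma adjacent_foldl_del_vertex:
  assumes "u \<notin> set xs" "w \<notin> set xs"
  shows "adjacent (foldl del_vertex G xs) u w = adjacent G u w"
  using assms by (auto simp: foldl_del_vertex adjacent_def)

text \<open>The new \<alpha> weight enters as the explicit sum \<open>q\<close>, so the inner sums
  of both brackets can be matched without dividing by \<open>d\<close>.\<close>

lemma (in twin_class) bracket_merge_twins:
  fixes d q :: 'r
  assumes a: "a \<in> S" and odd: "odd (card S)" and xs: "set xs = S - {a}"
    and q: "q = (\<Sum>U \<in> Pow S - {S}.
    (\<Prod>v \<in> S - U. alpha G v) * (\<Prod>t \<in> U. beta G t) * d ^ (card (S - U) - 1))"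
  shows "bracket d G = bracket d (reweight (foldl del_vertex G xs) a q (\<Prod>v \<in> S. beta G v))"
proof -
  define G' where "G' = reweight (foldl del_vertex G xs) a q (\<Prod>v \<in> S. beta G v)"
  have [simp]: "verts G' = insert a (verts G - S)" "marked G' = marked G - S" "free_loops G' = free_loops G"
      "alpha G' = (alpha G)(a := q)" "beta G' = (beta G)(a := \<Prod>v \<in> S. beta G v)"
    using a S_verts S_unmarked xs by (auto simp: G'_def foldl_del_vertex reweight_def)
  have adj: "adjacent G' u w = adjacent G u w" if "u \<notin> S - {a}" "w \<notin> S - {a}" for u w
  proof -
    have "adjacent G' u w = adjacent (foldl del_vertex G xs) u w"
      by (simp add: G'_def adjacent_def reweight_def)
    thus ?thesis using adjacent_foldl_del_vertex[of u xs w G] that xs by simp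
  qed
  have loop: "looped G' u = looped G u" if "u \<notin> S - {a}" for u
  proof -
    have "looped G' u = looped (foldl del_vertex G xs) u"
      by (simp add: G'_def looped_def reweight_def)
    thus ?thesis using looped_foldl_del_vertex[of u xs G] that xs by simp
  qed
  interpret G': twin_class G' "{a}"
    by unfold_locales (use finite_verts S_unmarked a S_unlooped S_nonadjacent adj loop in auto)
  let ?\<nu> = "\<lambda>T. kernel_dim (reduced_mat G (vertex_enum G) T)"
  let ?\<nu>' = "\<lambda>T. kernel_dim (reduced_mat G' (vertex_enum G') T)"
  have finS: "finite S" using S_verts finite_verts by (rule finite_subset)
  have V': "verts G' - {a} = verts G - S" using a by auto
  have tog: "toggled_entry G' T u w = toggled_entry G T u w"
    if "u \<notin> S - {a}" "w \<notin> S - {a}" for T u w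
    using adj[OF that] loop[OF that(1)] by (cases "u = w") (simp_all add: toggled_entry_def)
  have sur: "surviving G' T - {a} = surviving G T - S" for T
    using a tog by (auto simp: surviving_def)
  \<comment> \<open>No index in \<open>{a} \<union> (surviving G T - S)\<close> is a deleted twin,
    so the entries of \<open>G'\<close> there are those of \<open>G\<close>.\<close>
  have pow': "2 ^ ?\<nu>' (U \<union> T) = card (twin_null_vectors {a} U (surviving G T - S)
      (toggled_entry G T a) (toggled_entry G T a) (toggled_entry G T))"
    if "U \<subseteq> {a}" "T \<subseteq> verts G - S" for U T
  proof -
    have "twin_null_vectors {a} U (surviving G T - S) (toggled_entry G' T a) (toggled_entry G' T a) (toggled_entry G' T)
      = twin_null_vectors {a} U (surviving G T - S) (toggled_entry G T a) (toggled_entry G T a) (toggled_entry G T)"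
      unfolding twin_null_vectors_def by (simp add: tog)
    moreover have "T \<subseteq> verts G' - {a}" using that(2) unfolding V' .
    ultimately show ?thesis
      using G'.power_nullity[of a U T] that(1) by (simp only: sur insertI1)
  qed
  \<comment> \<open>Over \<open>bit\<close>, an odd \<open>card S\<close> is 1, as
    \<open>card_twin_null_vectors_all\<close> requires.\<close>
  have all: "?\<nu> (S \<union> T) = ?\<nu>' ({a} \<union> T)" if T: "T \<subseteq> verts G - S" for T
  proof -
    have "(2 :: nat) ^ ?\<nu> (S \<union> T) = 2 ^ ?\<nu>' ({a} \<union> T)"
      unfolding power_nullity[OF a subset_refl T] pow'[OF subset_refl T]
      using finS a odd by (intro card_twin_null_vectors_all) (auto elim!: oddE)
    thus ?thesis by simp
  qed
  have proper: "?\<nu> (U \<union> T) = card (S - U) - 1 + ?\<nu>' T" if T: "T \<subseteq> verts G - S" and U: "U \<subset> S" for U T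
  proof -
    have "(2 :: nat) ^ ?\<nu> (U \<union> T) = 2 ^ (card (S - U) - 1) * 2 ^ ?\<nu>' ({} \<union> T)"
      unfolding power_nullity[OF a psubset_imp_subset[OF U] T] pow'[OF empty_subsetI T]
      using finS a U by (subst card_twin_null_vectors_proper[of S _ a U]) auto
    also have "\<dots> = 2 ^ (card (S - U) - 1 + ?\<nu>' T)" by (simp add: power_add)
    finally show ?thesis by simp
  qed
  have "bracket d G = d ^ free_loops G * (\<Sum>T \<in> Pow (verts G - S).
    (\<Prod>v \<in> verts G - S - T. alpha G v) * (\<Prod>t \<in> T. beta G t) *
    (q * d ^ ?\<nu>' T + (\<Prod>v \<in> S. beta G v) * d ^ ?\<nu>' ({a} \<union> T)))"
    unfolding bracket_split[OF finite_verts S_verts]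
  proof (intro arg_cong2[of _ _ _ _ "(*)"] sum.cong refl)
    fix T assume "T \<in> Pow (verts G - S)"
    hence T: "T \<subseteq> verts G - S" by simp
    let ?g = "\<lambda>U. (\<Prod>v \<in> S - U. alpha G v) * (\<Prod>t \<in> U. beta G t)"
    \<comment> \<open>\<open>U = S\<close> carries the new \<beta> weight. For the proper subsets,
      \<open>?\<nu>' T\<close> does not depend on \<open>U\<close>, so its power of \<open>d\<close>
      factors out and leaves \<open>q\<close>.\<close>
    have "(\<Sum>U \<in> Pow S. ?g U * d ^ ?\<nu> (U \<union> T)) =
        ?g S * d ^ ?\<nu> (S \<union> T) + (\<Sum>U \<in> Pow S - {S}. ?g U * d ^ ?\<nu> (U \<union> T))"
      using finS by (subst sum.remove[of _ S]) auto
    also have "(\<Sum>U \<in> Pow S - {S}. ?g U * d ^ ?\<nu> (U \<union> T)) = q * d ^ ?\<nu>' T"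
      unfolding q sum_distrib_right
    proof (intro sum.cong refl)
      fix U assume "U \<in> Pow S - {S}"
      hence "U \<subset> S" by auto
      from proper[OF T this] show "?g U * d ^ ?\<nu> (U \<union> T) = ?g U * d ^ (card (S - U) - 1) * d ^ ?\<nu>' T"
        by (simp add: power_add mult_ac)
    qed
    finally show "(\<Sum>U \<in> Pow S. ?g U * d ^ ?\<nu> (U \<union> T)) =
        q * d ^ ?\<nu>' T + (\<Prod>v \<in> S. beta G v) * d ^ ?\<nu>' ({a} \<union> T)"
      using all[OF T] by (simp add: add.commute)
  qed
  also have "\<dots> = bracket d G'"
    unfolding bracket_split[OF G'.finite_verts G'.S_verts] V'
  proof (intro arg_cong2[of _ _ _ _ "(*)"] sum.cong refl)
    fix T assume T: "T \<in> Pow (verts G - S)"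
    show "(\<Prod>v \<in> verts G - S - T. alpha G v) = (\<Prod>v \<in> verts G - S - T. alpha G' v)"
      "(\<Prod>t \<in> T. beta G t) = (\<Prod>t \<in> T. beta G' t)"
      using T a by (auto intro!: prod.cong)
    \<comment> \<open>\<open>Pow {a}\<close> has two members: the empty set contributes the weight
      \<open>q\<close>, and \<open>{a}\<close> the product of the \<beta> weights.\<close>
    show "q * d ^ ?\<nu>' T + (\<Prod>v \<in> S. beta G v) * d ^ ?\<nu>' ({a} \<union> T) =
      (\<Sum>U \<in> Pow {a}. (\<Prod>v \<in> {a} - U. alpha G' v) * (\<Prod>t \<in> U. beta G' t) * d ^ ?\<nu>' (U \<union> T))"
      by (simp add: Pow_insert)
  qed simp
  finally show ?thesis by (simp add: G'_def)
qed

theorem corollary16: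
  fixes d :: "'r :: comm_ring_1"
    and G :: "('v, 'e, 'r) wm_graph"
    and v :: "nat \<Rightarrow> 'v"
    and k :: nat
  assumes d_nonzerodivisor: "\<And>x. d * x = 0 \<Longrightarrow> x = 0"
    and G: "weighted_marked_graph G"
    and k: "k \<ge> 3" "odd k"
    and v_distinct: "inj_on v {1..k}"
    and v_verts: "\<And>i. i \<in> {1..k} \<Longrightarrow> v i \<in> verts G"
    and v_unmarked: "\<And>i. i \<in> {1..k} \<Longrightarrow> v i \<notin> marked G"
    and v_unlooped: "\<And>i. i \<in> {1..k} \<Longrightarrow> \<not> looped G (v i)"
    and v_nonadjacent: "\<And>i j. i \<in> {1..k} \<Longrightarrow> j \<in> {1..k} \<Longrightarrow> i \<noteq> j \<Longrightarrow> \<not> adjacent G (v i) (v j)"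
    and v_twins: "\<And>i j. i \<in> {1..k} \<Longrightarrow> j \<in> {1..k} \<Longrightarrow> i \<noteq> j \<Longrightarrow> twins G (v i) (v j)"
  shows "bracket d G =
    (let b' = (\<Prod>i = 1..k. beta G (v i));
         a' = quotient_by d (- b' + (\<Prod>i = 1..k. alpha G (v i) * d + beta G (v i)))
     in bracket d (reweight (foldl del_vertex G (map v [2..<Suc k])) (v 1) a' b'))"
proof -
  define S where "S = v ` {1..k}"
  have v1: "v 1 \<in> S" using k(1) by (simp add: S_def)
  have cardS: "card S = k" using v_distinct by (simp add: S_def card_image)
  have finS: "finite S" by (simp add: S_def)
  interpret twin_class G S
  proof
    show "finite (verts G)" using G by (rule weighted_marked_graph.finite_verts)
    show "\<not> adjacent G s t" if "s \<in> S" "t \<in> S" for s t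
      using that v_nonadjacent by (auto simp: S_def) (metis adjacent_def)
    fix s t w assume st: "s \<in> S" "t \<in> S" and w: "w \<in> verts G - S"
    show "adjacent G s w = adjacent G t w"
    \<comment> \<open>The twin hypothesis concerns distinct vertices and leaves out only
      \<open>{s, t}\<close>, which does not contain \<open>w\<close> since \<open>w\<close> lies
      outside \<open>S\<close>.\<close>
    proof (cases "s = t")
      case False
      from st obtain i j where "i \<in> {1..k}" "j \<in> {1..k}" "s = v i" "t = v j"
        by (auto simp: S_def)
      with False v_twins[of i j] have "twins G s t" by auto
      with st w show ?thesis by (auto simp: twins_def neighbors_def)
    qed simp
  qed (use v_verts v_unmarked v_unlooped in \<open>auto simp: S_def\<close>)
  define q where "q = (\<Sum>U \<in> Pow S - {S}.
    (\<Prod>v \<in> S - U. alpha G v) * (\<Prod>t \<in> U. beta G t) * d ^ (card (S - U) - 1))"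
  have b: "(\<Prod>u \<in> S. beta G u) = (\<Prod>i = 1..k. beta G (v i))"
    and ab: "(\<Prod>u \<in> S. alpha G u * d + beta G u) = (\<Prod>i = 1..k. alpha G (v i) * d + beta G (v i))"
    using v_distinct by (simp_all add: S_def prod.reindex)
  have "- (\<Prod>i = 1..k. beta G (v i)) + (\<Prod>i = 1..k. alpha G (v i) * d + beta G (v i)) = d * q"
    unfolding q_def mult_sum_psubsets[OF finS] b ab by simp
  \<comment> \<open>Uniqueness of the quotient comes from \<open>d\<close> being no zero divisor;
    \<open>q\<close> is a witness for its existence.\<close>
  hence "quotient_by d (- (\<Prod>i = 1..k. beta G (v i)) + (\<Prod>i = 1..k. alpha G (v i) * d + beta G (v i))) = q"
    using quotient_by[OF d_nonzerodivisor] by simp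
  \<comment> \<open>The deleted indices are 2 to \<open>k\<close>; injectivity of \<open>v\<close>
    keeps \<open>v 1\<close> out of their image.\<close>
  moreover have "set (map v [2..<Suc k]) = S - {v 1}"
  proof -
    have "set (map v [2..<Suc k]) = v ` ({1..k} - {1})" by (auto simp: numeral_2_eq_2)
    also have "\<dots> = S - v ` {1}"
      unfolding S_def using v_distinct k(1) by (intro inj_on_image_set_diff) auto
    finally show ?thesis by simp
  qed
  ultimately show ?thesis
    using bracket_merge_twins[OF v1 _ _ q_def] k(2) cardS by (simp add: b Let_def)
qed

end
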